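(* If $\mathbf{d}$ and $\mathbf{e}$ are Turing degrees with $\mathbf{d}\not\le\mathbf{e}$, then there are continuum many coarse similarity classes that belong to the closure $\overline{\mathbf{d}}$ of $\mathbf{d}$ but not to the closure $\overline{\mathbf{e}}$ of $\mathbf{e}$.
   Context: For $A\subseteq\omega$ and $n\ge1$, $\rho_n(A)=|A\cap[0,n)|/n$, and $\overline{\rho}(A)=\limsup_n\rho_n(A)$. Sets $A,B$ are coarsely similar if $\lim_n \rho_n(A\bigtriangleup B)=0$; $[A]$ is the coarse similarity class of $A$, $\mathcal{S}$ the set of all classes, and $\delta([A],[B])=\overline{\rho}(A\bigtriangleup B)$ is a metric on $\mathcal{S}$. For a Turing degree $\mathbf{d}$, its closure $\overline{\mathbf{d}}$ is the closure in $(\mathcal{S},\delta)$ of $\{[A]: A\le_T \mathbf{d}\}$. *)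

theory Defs
  imports "HOL-Analysis.Analysis" "HOL-Library.Equipollence"
begin

section \<open>Relative computability and Turing degrees\<close>

text \<open>
  Codes for the partial functions that are recursive relative to an oracle
  (Kleene's schemata with one additional initial function). Codes carry no arities;
  a code applied to an argument list of unsuitable length merely diverges
  (or ignores surplus arguments).
\<close>

datatype rec_code =
    Zero
  | Succ
  | Proj nat
  | Oracle
  | Comp rec_code "rec_code list"
  | PrimRec rec_code rec_code
  | Mu rec_code

text \<open>\<open>computes f c xs y\<close>: with oracle \<open>f\<close>, the code \<open>c\<close> converges on the arguments \<open>xs\<close> with value \<open>y\<close>.
  In \<open>mu_rec\<close> all tests below the least zero are required to converge.\<close>

inductive computes :: "(nat \<Rightarrow> nat) \<Rightarrow> rec_code \<Rightarrow> nat list \<Rightarrow> nat \<Rightarrow> bool"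
  for f :: "nat \<Rightarrow> nat" where
  zero: "computes f Zero xs 0"
| succ: "computes f Succ [x] (Suc x)"
| proj: "i < length xs \<Longrightarrow> computes f (Proj i) xs (xs ! i)"
| query: "computes f Oracle [x] (f x)"
| comp: "list_all2 (\<lambda>c y. computes f c xs y) cs ys \<Longrightarrow> computes f c ys z
    \<Longrightarrow> computes f (Comp c cs) xs z"
| prim_rec_0: "computes f b xs y \<Longrightarrow> computes f (PrimRec b c) (0 # xs) y"
| prim_rec_Suc: "computes f (PrimRec b c) (n # xs) y \<Longrightarrow> computes f c (n # y # xs) z
    \<Longrightarrow> computes f (PrimRec b c) (Suc n # xs) z"
| mu_rec: "computes f c (n # xs) 0 \<Longrightarrow> \<forall>m<n. \<exists>y. computes f c (m # xs) (Suc y)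
    \<Longrightarrow> computes f (Mu c) xs n"

inductive_cases computes_ZeroE: "computes f Zero xs y"
inductive_cases computes_SuccE: "computes f Succ xs y"
inductive_cases computes_ProjE: "computes f (Proj i) xs y"
inductive_cases computes_OracleE: "computes f Oracle xs y"
inductive_cases computes_CompE: "computes f (Comp c cs) xs y"
inductive_cases computes_PrimRec_0E: "computes f (PrimRec b c) (0 # xs) y"
inductive_cases computes_PrimRec_SucE: "computes f (PrimRec b c) (Suc n # xs) y"
inductive_cases computes_MuE: "computes f (Mu c) xs y"

lemma computes_deterministic:
  "computes f c xs y \<Longrightarrow> computes f c xs z \<Longrightarrow> y = z"
proof (induction arbitrary: z rule: computes.induct)
  case (comp xs cs ys c w)
  from comp.prems obtain ys' where
    ys': "list_all2 (\<lambda>c y. computes f c xs y) cs ys'" and z: "computes f c ys' z"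
    by (rule computes_CompE)
  have "ys = ys'"
    using comp.IH(1) ys' by (auto simp: list_all2_conv_all_nth intro!: nth_equalityI)
  with z comp.IH(2) show ?case by simp
next
  case (prim_rec_Suc b c n xs y v w)
  from prim_rec_Suc.prems obtain y' where
    "computes f (PrimRec b c) (n # xs) y'" "computes f c (n # y' # xs) w"
    by (rule computes_PrimRec_SucE)
  with prim_rec_Suc.IH show ?case by blast
next
  case (mu_rec c n xs)
  from mu_rec.prems have z: "computes f c (z # xs) 0" "\<forall>m<z. \<exists>y. computes f c (m # xs) (Suc y)"
    by (blast elim: computes_MuE)+
  show ?case
  proof (rule linorder_cases[of n z])
    assume "n < z"
    with z(2) obtain y where "computes f c (n # xs) (Suc y)" by blast
    with mu_rec.IH(1) show ?thesis by force
  next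
    assume "z < n"
    with mu_rec.IH(2) z(1) show ?thesis by force
  qed
qed (blast elim: computes_ZeroE computes_SuccE computes_ProjE computes_OracleE
  computes_PrimRec_0E)+

definition char_fun :: "nat set \<Rightarrow> nat \<Rightarrow> nat" where
  "char_fun A x = of_bool (x \<in> A)"

definition turing_le :: "nat set \<Rightarrow> nat set \<Rightarrow> bool" (infix "\<le>\<^sub>T" 50) where
  "A \<le>\<^sub>T B \<longleftrightarrow> (\<exists>c. \<forall>x. computes (char_fun B) c [x] (char_fun A x))"

primrec oracle_subst :: "rec_code \<Rightarrow> rec_code \<Rightarrow> rec_code" where
  "oracle_subst p Zero = Zero"
| "oracle_subst p Succ = Succ"
| "oracle_subst p (Proj i) = Proj i"
| "oracle_subst p Oracle = p"
| "oracle_subst p (Comp c cs) = Comp (oracle_subst p c) (map (oracle_subst p) cs)"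
| "oracle_subst p (PrimRec b c) = PrimRec (oracle_subst p b) (oracle_subst p c)"
| "oracle_subst p (Mu c) = Mu (oracle_subst p c)"

lemma computes_oracle_subst:
  assumes p: "\<And>x. computes g p [x] (f x)"
  shows "computes f c xs y \<Longrightarrow> computes g (oracle_subst p c) xs y"
proof (induction rule: computes.induct)
  case (comp xs cs ys c z)
  then have "list_all2 (\<lambda>c y. computes g c xs y) (map (oracle_subst p) cs) ys"
    by (auto simp: list_all2_conv_all_nth)
  with comp.IH(2) show ?case by (auto intro: computes.comp)
next
  case (mu_rec c n xs)
  then show ?case by (auto intro!: computes.mu_rec)
qed (auto intro: computes.intros p)

lemma turing_le_refl: "A \<le>\<^sub>T A"
  unfolding turing_le_def using computes.query by blast

lemma turing_le_trans: "A \<le>\<^sub>T B \<Longrightarrow> B \<le>\<^sub>T C \<Longrightarrow> A \<le>\<^sub>T C"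
  unfolding turing_le_def using computes_oracle_subst by metis

definition turing_equiv :: "nat set \<Rightarrow> nat set \<Rightarrow> bool" (infix "\<equiv>\<^sub>T" 50) where
  "A \<equiv>\<^sub>T B \<longleftrightarrow> A \<le>\<^sub>T B \<and> B \<le>\<^sub>T A"

quotient_type turing_degree = "nat set" / turing_equiv
  morphisms rep_degree degree_of
  by (rule equivpI)
     (auto simp: reflp_def symp_def transp_def turing_equiv_def
       intro: turing_le_refl turing_le_trans)

instantiation turing_degree :: order
begin

lift_definition less_eq_turing_degree :: "turing_degree \<Rightarrow> turing_degree \<Rightarrow> bool"
  is turing_le
  by (auto simp: turing_equiv_def intro: turing_le_trans)

definition less_turing_degree :: "turing_degree \<Rightarrow> turing_degree \<Rightarrow> bool" where
  "less_turing_degree d e \<longleftrightarrow> d \<le> e \<and> \<not> e \<le> d"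

instance
proof
  fix a b c :: turing_degree
  show "a < b \<longleftrightarrow> a \<le> b \<and> \<not> b \<le> a" by (rule less_turing_degree_def)
  show "a \<le> a" by transfer (rule turing_le_refl)
  show "a \<le> b \<Longrightarrow> b \<le> c \<Longrightarrow> a \<le> c" by transfer (rule turing_le_trans)
  show "a \<le> b \<Longrightarrow> b \<le> a \<Longrightarrow> a = b" by transfer (simp add: turing_equiv_def)
qed

end


section \<open>Coarse similarity classes and the density metric\<close>

definition partial_density :: "nat \<Rightarrow> nat set \<Rightarrow> real" where
  "partial_density n A = real (card (A \<inter> {0..<n})) / real n"

definition upper_density :: "nat set \<Rightarrow> real" where
  "upper_density A = real_of_ereal (limsup (\<lambda>n. ereal (partial_density n A)))"

definition coarsely_similar :: "nat set \<Rightarrow> nat set \<Rightarrow> bool" where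
  "coarsely_similar A B \<longleftrightarrow> (\<lambda>n. partial_density n (sym_diff A B)) \<longlonglongrightarrow> 0"

lemma partial_density_nonneg: "0 \<le> partial_density n A"
  by (simp add: partial_density_def)

lemma partial_density_le_1: "partial_density n A \<le> 1"
proof -
  have "card (A \<inter> {0..<n}) \<le> card {0..<n}" by (rule card_mono) auto
  then show ?thesis by (auto simp: partial_density_def divide_le_eq)
qed

lemma partial_density_subadd:
  assumes "C \<subseteq> A \<union> B"
  shows "partial_density n C \<le> partial_density n A + partial_density n B"
proof -
  have "card (C \<inter> {0..<n}) \<le> card ((A \<inter> {0..<n}) \<union> (B \<inter> {0..<n}))"
    using assms by (intro card_mono) auto
  also have "\<dots> \<le> card (A \<inter> {0..<n}) + card (B \<inter> {0..<n})" by (rule card_Un_le)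
  finally show ?thesis
    by (simp add: partial_density_def divide_right_mono flip: add_divide_distrib of_nat_add)
qed

lemma ereal_upper_density: "ereal (upper_density A) = limsup (\<lambda>n. ereal (partial_density n A))"
proof -
  have le: "limsup (\<lambda>n. ereal (partial_density n A)) \<le> 1"
    by (intro Limsup_bounded always_eventually) (simp add: partial_density_le_1)
  have "0 \<le> liminf (\<lambda>n. ereal (partial_density n A))"
    by (intro Liminf_bounded always_eventually) (simp add: partial_density_nonneg)
  also have "\<dots> \<le> limsup (\<lambda>n. ereal (partial_density n A))"
    by (intro Liminf_le_Limsup) simp
  finally show ?thesis
    using le unfolding upper_density_def
    by (cases "limsup (\<lambda>n. ereal (partial_density n A))") auto
qed

lemma upper_density_nonneg: "0 \<le> upper_density A"
proof -
  have "0 \<le> liminf (\<lambda>n. ereal (partial_density n A))"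
    by (intro Liminf_bounded always_eventually) (simp add: partial_density_nonneg)
  also have "\<dots> \<le> limsup (\<lambda>n. ereal (partial_density n A))"
    by (intro Liminf_le_Limsup) simp
  finally show ?thesis by (simp flip: ereal_upper_density)
qed

lemma upper_density_subadd:
  assumes "C \<subseteq> A \<union> B"
  shows "upper_density C \<le> upper_density A + upper_density B"
proof -
  have "limsup (\<lambda>n. ereal (partial_density n C))
      \<le> limsup (\<lambda>n. ereal (partial_density n A) + ereal (partial_density n B))"
    using partial_density_subadd[OF assms] by (intro Limsup_mono always_eventually) simp
  also have "\<dots> \<le> limsup (\<lambda>n. ereal (partial_density n A)) + limsup (\<lambda>n. ereal (partial_density n B))"
    by (rule ereal_limsup_add_mono)
  finally show ?thesis by (simp flip: ereal_upper_density)
qed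

lemma upper_density_eq_0_iff: "upper_density A = 0 \<longleftrightarrow> (\<lambda>n. partial_density n A) \<longlonglongrightarrow> 0"
proof
  assume "upper_density A = 0"
  then have ls: "limsup (\<lambda>n. ereal (partial_density n A)) = 0"
    using ereal_upper_density[of A] by (simp add: zero_ereal_def)
  have "0 \<le> liminf (\<lambda>n. ereal (partial_density n A))"
    by (intro Liminf_bounded always_eventually) (simp add: partial_density_nonneg)
  moreover have "liminf (\<lambda>n. ereal (partial_density n A)) \<le> limsup (\<lambda>n. ereal (partial_density n A))"
    by (intro Liminf_le_Limsup) simp
  ultimately have "(\<lambda>n. ereal (partial_density n A)) \<longlonglongrightarrow> ereal 0"
    using ls by (subst tendsto_iff_Liminf_eq_Limsup) (auto simp: zero_ereal_def)
  then show "(\<lambda>n. partial_density n A) \<longlonglongrightarrow> 0" by (simp only: lim_ereal)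
next
  assume "(\<lambda>n. partial_density n A) \<longlonglongrightarrow> 0"
  then have "(\<lambda>n. ereal (partial_density n A)) \<longlonglongrightarrow> ereal 0" by (simp only: lim_ereal)
  then have "limsup (\<lambda>n. ereal (partial_density n A)) = ereal 0"
    by (intro lim_imp_Limsup) auto
  then show "upper_density A = 0" by (simp flip: ereal_upper_density)
qed

lemma coarsely_similar_iff: "coarsely_similar A B \<longleftrightarrow> upper_density (sym_diff A B) = 0"
  by (simp add: coarsely_similar_def upper_density_eq_0_iff)

lemma upper_density_sym_diff_triangle:
  "upper_density (sym_diff A C) \<le> upper_density (sym_diff A B) + upper_density (sym_diff B C)"
  by (rule upper_density_subadd) auto

lemma upper_density_sym_diff_commute:
  "upper_density (sym_diff A B) = upper_density (sym_diff B A)"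
  by (simp add: Un_commute)

lemma coarsely_similar_refl: "coarsely_similar A A"
  by (simp add: coarsely_similar_def partial_density_def)

lemma coarsely_similar_sym: "coarsely_similar A B \<Longrightarrow> coarsely_similar B A"
  by (simp add: coarsely_similar_iff upper_density_sym_diff_commute)

lemma coarsely_similar_trans:
  "coarsely_similar A B \<Longrightarrow> coarsely_similar B C \<Longrightarrow> coarsely_similar A C"
  using upper_density_sym_diff_triangle[of A C B] upper_density_nonneg[of "sym_diff A C"]
  unfolding coarsely_similar_iff by linarith

quotient_type coarse_class = "nat set" / coarsely_similar
  morphisms rep_coarse_class coarse_class_of
  by (rule equivpI)
     (auto simp: reflp_def symp_def transp_def
       intro: coarsely_similar_refl coarsely_similar_sym coarsely_similar_trans)

instantiation coarse_class :: metric_space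
begin

lift_definition dist_coarse_class :: "coarse_class \<Rightarrow> coarse_class \<Rightarrow> real"
  is "\<lambda>A B. upper_density (sym_diff A B)"
proof -
  fix A A' B B' :: "nat set"
  assume "coarsely_similar A A'" "coarsely_similar B B'"
  then have z: "upper_density (sym_diff A A') = 0" "upper_density (sym_diff B B') = 0"
    by (simp_all add: coarsely_similar_iff)
  show "upper_density (sym_diff A B) = upper_density (sym_diff A' B')"
    using z upper_density_sym_diff_triangle[of A B A'] upper_density_sym_diff_triangle[of A' B B']
      upper_density_sym_diff_triangle[of A' B' A] upper_density_sym_diff_triangle[of A B' B]
      upper_density_sym_diff_commute[of A A'] upper_density_sym_diff_commute[of B B']
    by linarith
qed

definition uniformity_coarse_class :: "(coarse_class \<times> coarse_class) filter" where
  "uniformity_coarse_class = (INF e\<in>{0<..}. principal {(x, y). dist x y < e})"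

definition open_coarse_class :: "coarse_class set \<Rightarrow> bool" where
  "open_coarse_class U \<longleftrightarrow> (\<forall>x\<in>U. \<forall>\<^sub>F (x', y) in uniformity. x' = x \<longrightarrow> y \<in> U)"

instance
proof
  fix x y z :: coarse_class and U :: "coarse_class set"
  show "uniformity = (INF e\<in>{0<..}. principal {(x :: coarse_class, y). dist x y < e})"
    by (rule uniformity_coarse_class_def)
  show "open U \<longleftrightarrow> (\<forall>x\<in>U. \<forall>\<^sub>F (x', y) in uniformity. x' = x \<longrightarrow> y \<in> U)"
    by (rule open_coarse_class_def)
  show "dist x y = 0 \<longleftrightarrow> x = y"
    by transfer (simp add: coarsely_similar_iff)
  show "dist x y \<le> dist x z + dist y z"
  proof transfer
    fix A B C :: "nat set"
    show "upper_density (sym_diff A B)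
        \<le> upper_density (sym_diff A C) + upper_density (sym_diff B C)"
      using upper_density_sym_diff_triangle[of A B C] upper_density_sym_diff_commute[of B C]
      by linarith
  qed
qed

end

definition degree_closure :: "turing_degree \<Rightarrow> coarse_class set" where
  "degree_closure d = closure {coarse_class_of A |A. degree_of A \<le> d}"

end

theory Submission
  imports Defs
begin

text \<open>Let \<open>D\<close> have degree \<open>d\<close> and let \<open>E\<close> have degree \<open>e\<close>. Spread \<open>D\<close> to \<open>S = {x. log2 x \<in> D}\<close>.
  By majority vote on dyadic blocks, any set at distance less than 1/4 from \<open>S\<close> computes \<open>D\<close>, so
  every \<open>E\<close>-computable set is at distance at least 1/4 from \<open>S\<close>. Now perturb \<open>S\<close>: let \<open>R A\<close> consist
  of the numbers with 2-adic valuation \<open>k + 3\<close> for some \<open>k \<in> A\<close>. It lies in the multiples of 8, so it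
  has upper density at most 1/8, and it is a limit of the computable sets \<open>R (A \<inter> {..<n})\<close>; hence the symmetric difference
  of \<open>S\<close> and \<open>R A\<close> is in the closure of \<open>d\<close> but not in that of \<open>e\<close>. Different \<open>A\<close> give different
  classes because every set of numbers with a fixed 2-adic valuation has positive density.\<close>

section \<open>Closure properties of relative recursiveness\<close>

text \<open>Only lists of length \<open>n\<close> are constrained, so \<open>g\<close> may use total
  list operations such as \<open>!\<close> and \<open>drop\<close> freely. One code serves all
  inputs.\<close>

definition recursive_in :: "(nat \<Rightarrow> nat) \<Rightarrow> nat \<Rightarrow> (nat list \<Rightarrow> nat) \<Rightarrow> bool" where
  "recursive_in f n g \<longleftrightarrow> (\<exists>c. \<forall>xs. length xs = n \<longrightarrow> computes f c xs (g xs))"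

lemma recursive_in_cong:
  assumes "recursive_in f n g" "\<And>xs. length xs = n \<Longrightarrow> g xs = h xs"
  shows "recursive_in f n h"
  using assms unfolding recursive_in_def by auto

lemma recursive_in_nth: "i < n \<Longrightarrow> recursive_in f n (\<lambda>xs. xs ! i)"
  unfolding recursive_in_def by (auto intro!: exI[of _ "Proj i"] computes.proj)

lemma recursive_in_comp:
  assumes h: "recursive_in f m h"
    and gs: "length gs = m" "\<And>g. g \<in> set gs \<Longrightarrow> recursive_in f n g"
  shows "recursive_in f n (\<lambda>xs. h (map (\<lambda>g. g xs) gs))"
proof -
  obtain c where c: "\<And>ys. length ys = m \<Longrightarrow> computes f c ys (h ys)"
    using h unfolding recursive_in_def by auto
  obtain k where k: "\<And>g xs. g \<in> set gs \<Longrightarrow> length xs = n \<Longrightarrow> computes f (k g) xs (g xs)"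
    using gs(2) unfolding recursive_in_def by metis
  have "computes f (Comp c (map k gs)) xs (h (map (\<lambda>g. g xs) gs))" if "length xs = n" for xs
  proof (rule computes.comp)
    show "list_all2 (\<lambda>c y. computes f c xs y) (map k gs) (map (\<lambda>g. g xs) gs)"
      using k that by (auto simp: list_all2_conv_all_nth)
    show "computes f c (map (\<lambda>g. g xs) gs) (h (map (\<lambda>g. g xs) gs))"
      using c gs(1) by simp
  qed
  then show ?thesis
    unfolding recursive_in_def by blast
qed

lemma recursive_in_app:
  assumes "recursive_in f 1 (\<lambda>xs. h (xs ! 0))" "recursive_in f n g"
  shows "recursive_in f n (\<lambda>xs. h (g xs))"
  using recursive_in_comp[OF assms(1), of "[g]"] assms(2) by simp

lemma recursive_in_Suc:
  assumes "recursive_in f n g"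
  shows "recursive_in f n (\<lambda>xs. Suc (g xs))"
proof (rule recursive_in_app[OF _ assms])
  show "recursive_in f 1 (\<lambda>xs. Suc (xs ! 0))"
    unfolding recursive_in_def
    by (auto simp: length_Suc_conv intro!: exI[of _ Succ] computes.succ)
qed

lemma recursive_in_oracle:
  assumes "recursive_in f n g"
  shows "recursive_in f n (\<lambda>xs. f (g xs))"
proof (rule recursive_in_app[OF _ assms])
  show "recursive_in f 1 (\<lambda>xs. f (xs ! 0))"
    unfolding recursive_in_def
    by (auto simp: length_Suc_conv intro!: exI[of _ Oracle] computes.query)
qed

lemma recursive_in_const: "recursive_in f n (\<lambda>_. k)"
proof (induction k)
  case 0
  show ?case
    unfolding recursive_in_def by (auto intro: computes.zero)
qed (rule recursive_in_Suc)

lemma recursive_in_drop: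
  assumes "recursive_in f n g"
  shows "recursive_in f (m + n) (\<lambda>xs. g (drop m xs))"
proof (rule recursive_in_cong)
  show "recursive_in f (m + n)
      (\<lambda>xs. g (map (\<lambda>h. h xs) (map (\<lambda>i xs. xs ! (m + i)) [0..<n])))"
    by (rule recursive_in_comp[OF assms]) (auto intro!: recursive_in_nth)
  show "g (map (\<lambda>h. h xs) (map (\<lambda>i xs. xs ! (m + i)) [0..<n])) = g (drop m xs)"
    if "length xs = m + n" for xs
    using that by (intro arg_cong[of _ _ g] nth_equalityI) auto
qed

text \<open>The main device for exhibiting recursive functions. \<open>PrimRec\<close> recurses on
  its first argument; composing it with \<open>k\<close> and the projections gives recursion up to
  \<open>k xs\<close> with all of \<open>xs\<close> still available as parameters.\<close>

lemma recursive_in_rec_nat: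
  assumes b: "recursive_in f n b"
    and s: "recursive_in f (2 + n) (\<lambda>ys. s (ys ! 0) (ys ! 1) (drop 2 ys))"
    and k: "recursive_in f n k"
  shows "recursive_in f n (\<lambda>xs. rec_nat (b xs) (\<lambda>i y. s i y xs) (k xs))"
proof -
  obtain cb where cb: "\<And>xs. length xs = n \<Longrightarrow> computes f cb xs (b xs)"
    using b unfolding recursive_in_def by auto
  obtain cs where cs: "\<And>ys. length ys = 2 + n \<Longrightarrow>
      computes f cs ys (s (ys ! 0) (ys ! 1) (drop 2 ys))"
    using s unfolding recursive_in_def by blast
  have "computes f (PrimRec cb cs) (i # xs) (rec_nat (b xs) (\<lambda>i y. s i y xs) i)"
    if "length xs = n" for i xs
  proof (induction i)
    case 0
    then show ?case using cb that by (auto intro: computes.prim_rec_0)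
  next
    case (Suc i)
    then show ?case
      using cs[of "i # rec_nat (b xs) (\<lambda>i y. s i y xs) i # xs"] that
      by (auto intro: computes.prim_rec_Suc)
  qed
  then have "recursive_in f (Suc n)
      (\<lambda>ys. rec_nat (b (drop 1 ys)) (\<lambda>i y. s i y (drop 1 ys)) (ys ! 0))"
    unfolding recursive_in_def by (intro exI[of _ "PrimRec cb cs"]) (auto simp: length_Suc_conv)
  then have "recursive_in f n (\<lambda>xs. (\<lambda>ys. rec_nat (b (drop 1 ys)) (\<lambda>i y. s i y (drop 1 ys)) (ys ! 0))
      (map (\<lambda>g. g xs) (k # map (\<lambda>i xs. xs ! i) [0..<n])))"
    by (rule recursive_in_comp) (auto intro: recursive_in_nth k)
  then show ?thesis
  proof (rule recursive_in_cong)
    fix xs :: "nat list"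
    assume "length xs = n"
    then have "map (\<lambda>i. xs ! i) [0..<n] = xs"
      using map_nth by blast
    then show "(\<lambda>ys. rec_nat (b (drop 1 ys)) (\<lambda>i y. s i y (drop 1 ys)) (ys ! 0))
      (map (\<lambda>g. g xs) (k # map (\<lambda>i xs. xs ! i) [0..<n])) = rec_nat (b xs) (\<lambda>i y. s i y xs) (k xs)"
      by (simp add: comp_def)
  qed
qed

lemma recursive_in_add:
  assumes "recursive_in f n g" "recursive_in f n h"
  shows "recursive_in f n (\<lambda>xs. g xs + h xs)"
proof (rule recursive_in_cong)
  show "recursive_in f n (\<lambda>xs. rec_nat (g xs) (\<lambda>i y. Suc y) (h xs))"
    by (rule recursive_in_rec_nat) (auto intro!: assms recursive_in_Suc recursive_in_nth)
  show "rec_nat (g xs) (\<lambda>i y. Suc y) (h xs) = g xs + h xs" for xs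
    by (induction "h xs" arbitrary: h) (metis nat.rec add_0_right add_Suc_right)+
qed

lemma recursive_in_diff:
  assumes "recursive_in f n g" "recursive_in f n h"
  shows "recursive_in f n (\<lambda>xs. g xs - h xs)"
proof -
  have pred: "recursive_in f 1 (\<lambda>xs. xs ! 0 - 1)"
  proof (rule recursive_in_cong)
    show "recursive_in f 1 (\<lambda>xs. rec_nat 0 (\<lambda>i y. i) (xs ! 0))"
      by (rule recursive_in_rec_nat) (auto intro!: recursive_in_const recursive_in_nth)
    show "rec_nat 0 (\<lambda>i y. i) (xs ! 0) = xs ! 0 - 1" for xs :: "nat list"
      by (cases "xs ! 0") auto
  qed
  have rec: "rec_nat a (\<lambda>i y. y - 1) b = a - b" for a b :: nat
    by (induction b) auto
  have "recursive_in f n (\<lambda>xs. rec_nat (g xs) (\<lambda>i y. y - 1) (h xs))"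
    by (rule recursive_in_rec_nat)
      (auto intro!: assms recursive_in_app[OF pred, simplified] recursive_in_nth)
  then show ?thesis by (simp only: rec)
qed

text \<open>Definition by cases is a recursion whose step ignores the previous value: no step yields
  \<open>a\<close>, any positive number of steps yields \<open>b\<close>.\<close>

lemma recursive_in_if_zero:
  assumes "recursive_in f n g" "recursive_in f n a" "recursive_in f n b"
  shows "recursive_in f n (\<lambda>xs. if g xs = 0 then a xs else b xs)"
proof (rule recursive_in_cong)
  show "recursive_in f n (\<lambda>xs. rec_nat (a xs) (\<lambda>i y. b xs) (g xs))"
    by (rule recursive_in_rec_nat[OF assms(2) recursive_in_drop[OF assms(3)] assms(1)])
  show "rec_nat (a xs) (\<lambda>i y. b xs) (g xs) = (if g xs = 0 then a xs else b xs)" for xs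
    by (cases "g xs") auto
qed

lemma recursive_in_if_less:
  assumes "recursive_in f n g" "recursive_in f n h" "recursive_in f n a" "recursive_in f n b"
  shows "recursive_in f n (\<lambda>xs. if g xs < h xs then a xs else b xs)"
  using recursive_in_if_zero[OF recursive_in_diff[OF assms(2,1)] assms(4,3)]
  by (rule recursive_in_cong) auto

lemma recursive_in_power2:
  assumes "recursive_in f n g"
  shows "recursive_in f n (\<lambda>xs. 2 ^ g xs)"
proof -
  have rec: "rec_nat 1 (\<lambda>i y. y + y) b = (2::nat) ^ b" for b
    by (induction b) auto
  have "recursive_in f n (\<lambda>xs. rec_nat 1 (\<lambda>i y. y + y) (g xs))"
    by (rule recursive_in_rec_nat)
      (auto intro!: assms recursive_in_const recursive_in_add recursive_in_nth)
  then show ?thesis by (simp only: rec)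
qed

section \<open>From recursive functions to Turing reducibility of sets\<close>

lemma turing_le_iff_recursive_in:
  "A \<le>\<^sub>T B \<longleftrightarrow> recursive_in (char_fun B) 1 (\<lambda>xs. char_fun A (xs ! 0))"
  unfolding turing_le_def recursive_in_def by (simp add: length_Suc_conv) (metis nth_Cons_0)

text \<open>Allows a decision function with arbitrary positive values on \<open>A\<close>; later
  reductions then need no normalization to 0 and 1.\<close>

lemma turing_le_if_recursive_in:
  assumes "recursive_in (char_fun B) 1 (\<lambda>xs. g (xs ! 0))"
    and "\<And>x. x \<in> A \<longleftrightarrow> 0 < g x"
  shows "A \<le>\<^sub>T B"
proof -
  have "recursive_in (char_fun B) 1 (\<lambda>xs. if g (xs ! 0) = 0 then 0 else 1)"
    by (rule recursive_in_if_zero[OF assms(1) recursive_in_const recursive_in_const])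
  then show ?thesis
    unfolding turing_le_iff_recursive_in
    by (rule recursive_in_cong) (simp add: char_fun_def assms(2))
qed

lemma turing_le_Un:
  assumes "A \<le>\<^sub>T C" "B \<le>\<^sub>T C"
  shows "A \<union> B \<le>\<^sub>T C"
proof (rule turing_le_if_recursive_in)
  show "recursive_in (char_fun C) 1 (\<lambda>xs. char_fun A (xs ! 0) + char_fun B (xs ! 0))"
    using assms unfolding turing_le_iff_recursive_in by (rule recursive_in_add)
qed (auto simp: char_fun_def)

lemma turing_le_Diff:
  assumes "A \<le>\<^sub>T C" "B \<le>\<^sub>T C"
  shows "A - B \<le>\<^sub>T C"
proof (rule turing_le_if_recursive_in)
  show "recursive_in (char_fun C) 1 (\<lambda>xs. char_fun A (xs ! 0) - char_fun B (xs ! 0))"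
    using assms unfolding turing_le_iff_recursive_in by (rule recursive_in_diff)
qed (auto simp: char_fun_def)

lemma turing_le_finite_UN:
  assumes "finite F" "\<And>k. k \<in> F \<Longrightarrow> S k \<le>\<^sub>T C"
  shows "(\<Union>k\<in>F. S k) \<le>\<^sub>T C"
  using assms
proof (induction F rule: finite_induct)
  case empty
  show ?case
    by (rule turing_le_if_recursive_in[where g = "\<lambda>_. 0"]) (auto intro: recursive_in_const)
qed (auto intro: turing_le_Un)

lemma turing_le_finite:
  assumes "finite F"
  shows "F \<le>\<^sub>T C"
proof -
  \<comment> \<open>Subtraction is truncated, so the sum is the distance of \<open>x\<close> from
    \<open>k\<close> and the witness is positive only at \<open>x = k\<close>.\<close>
  have "{k} \<le>\<^sub>T C" for k
    by (rule turing_le_if_recursive_in[where g = "\<lambda>x. 1 - ((x - k) + (k - x))"])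
      (auto intro!: recursive_in_const recursive_in_add recursive_in_diff recursive_in_nth)
  with assms have "(\<Union>k\<in>F. {k}) \<le>\<^sub>T C"
    by (rule turing_le_finite_UN)
  then show ?thesis by simp
qed

lemma turing_le_multiples:
  assumes "0 < m"
  shows "{x. m dvd x} \<le>\<^sub>T C"
proof (rule turing_le_if_recursive_in)
  have mod: "rec_nat 0 (\<lambda>i y. if Suc y < m then Suc y else 0) x = x mod m" for x
    using assms mod_less_divisor[of m] by (induction x) (auto simp: mod_Suc Suc_lessI)
  have "recursive_in (char_fun C) 1
      (\<lambda>xs. rec_nat 0 (\<lambda>i y. if Suc y < m then Suc y else 0) (xs ! 0))"
    by (rule recursive_in_rec_nat)
      (auto intro!: recursive_in_const recursive_in_nth recursive_in_if_less recursive_in_Suc)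
  then show "recursive_in (char_fun C) 1 (\<lambda>xs. 1 - xs ! 0 mod m)"
    unfolding mod by (intro recursive_in_diff recursive_in_const)
  show "x \<in> {x. m dvd x} \<longleftrightarrow> 0 < 1 - x mod m" for x
    by (auto simp: dvd_eq_mod_eq_0)
qed


section \<open>Spreading a set over dyadic blocks\<close>

text \<open>Rounded-down binary logarithm with value 0 at 0. Its primitive recursive form can be fed
  directly to \<open>recursive_in_rec_nat\<close>.\<close>

primrec log2 :: "nat \<Rightarrow> nat" where
  "log2 0 = 0"
| "log2 (Suc x) = (if Suc x < 2 ^ Suc (log2 x) then log2 x else Suc (log2 x))"

lemma log2_bounds: "x < 2 ^ Suc (log2 x) \<and> (0 < x \<longrightarrow> 2 ^ log2 x \<le> x)"
  by (induction x) auto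

lemma log2_eq:
  assumes "2 ^ n \<le> x" "x < 2 ^ Suc n"
  shows "log2 x = n"
proof -
  have "0 < x"
    using assms(1) by (metis gr0I le_zero_eq power_not_zero zero_neq_numeral)
  then have less: "(2::nat) ^ n < 2 ^ Suc (log2 x)" "(2::nat) ^ log2 x < 2 ^ Suc n"
    using log2_bounds[of x] assms by linarith+
  have "n < Suc (log2 x)" "log2 x < Suc n"
    using power_less_imp_less_exp[OF _ less(1)] power_less_imp_less_exp[OF _ less(2)] by simp_all
  then show ?thesis by simp
qed

definition dyadic_spread :: "nat set \<Rightarrow> nat set" where
  "dyadic_spread D = {x. log2 x \<in> D}"

lemma dyadic_spread_turing_le: "dyadic_spread D \<le>\<^sub>T D"
proof (rule turing_le_if_recursive_in)
  have rec: "rec_nat 0 (\<lambda>i y. if Suc i < 2 ^ Suc y then y else Suc y) x = log2 x" for x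
    by (induction x) auto
  have "recursive_in (char_fun D) 1
      (\<lambda>xs. rec_nat 0 (\<lambda>i y. if Suc i < 2 ^ Suc y then y else Suc y) (xs ! 0))"
    by (rule recursive_in_rec_nat)
      (intro recursive_in_const recursive_in_nth recursive_in_if_less recursive_in_Suc
        recursive_in_power2; simp)+
  then show "recursive_in (char_fun D) 1 (\<lambda>xs. char_fun D (log2 (xs ! 0)))"
    unfolding rec by (rule recursive_in_oracle)
  show "x \<in> dyadic_spread D \<longleftrightarrow> 0 < char_fun D (log2 x)" for x
    by (simp add: dyadic_spread_def char_fun_def)
qed

text \<open>Counting below a bound is a recursion that sums oracle values, and a block count is the
  difference of two such counts.\<close>

lemma dyadic_majority_turing_le:
  "{n. 2 ^ n < 2 * card (C \<inter> {2 ^ n..<2 ^ Suc n})} \<le>\<^sub>T C"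
proof (rule turing_le_if_recursive_in)
  let ?count = "\<lambda>n. card (C \<inter> {0..<n})"
  have rec: "rec_nat 0 (\<lambda>i y. y + char_fun C i) x = ?count x" for x
    by (induction x) (auto simp: char_fun_def atLeastLessThanSuc)
  have "recursive_in (char_fun C) 1 (\<lambda>xs. rec_nat 0 (\<lambda>i y. y + char_fun C i) (xs ! 0))"
    by (rule recursive_in_rec_nat)
      (intro recursive_in_const recursive_in_nth recursive_in_add recursive_in_oracle; simp)+
  then have count: "recursive_in (char_fun C) 1 (\<lambda>xs. ?count (xs ! 0))"
    unfolding rec .
  let ?block = "\<lambda>n. ?count (2 ^ Suc n) - ?count (2 ^ n)"
  show "recursive_in (char_fun C) 1 (\<lambda>xs. (?block (xs ! 0) + ?block (xs ! 0)) - 2 ^ (xs ! 0))"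
    by (intro recursive_in_diff recursive_in_add recursive_in_power2 recursive_in_Suc
        recursive_in_app[where h = ?count, OF count] recursive_in_nth) simp_all
  have "C \<inter> {2 ^ n..<2 ^ Suc n} = (C \<inter> {0..<2 ^ Suc n}) - (C \<inter> {0..<2 ^ n})" for n
    by auto
  then have "card (C \<inter> {2 ^ n..<2 ^ Suc n}) = ?block n" for n
    by (simp only:) (rule card_Diff_subset, auto)
  then show "n \<in> {n. 2 ^ n < 2 * card (C \<inter> {2 ^ n..<2 ^ Suc n})}
      \<longleftrightarrow> 0 < (?block n + ?block n) - 2 ^ n" for n
    by auto
qed

text \<open>If a majority vote over \<open>[2^n, 2^(n+1))\<close> decodes \<open>n \<in> D\<close> wrongly, then at least half of
  the block, hence a quarter of \<open>[0, 2^(n+1))\<close>, consists of errors.\<close>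

lemma turing_le_if_near_dyadic_spread:
  assumes "upper_density (sym_diff C (dyadic_spread D)) < 1 / 4"
  shows "D \<le>\<^sub>T C"
proof -
  let ?E = "sym_diff C (dyadic_spread D)"
  let ?B = "\<lambda>n::nat. {2 ^ n..<2 ^ Suc n :: nat}"
  define M where "M = {n. 2 ^ n < 2 * card (C \<inter> ?B n)}"
  have "limsup (\<lambda>n. ereal (partial_density n ?E)) < ereal (1 / 4)"
    using assms by (simp flip: ereal_upper_density)
  then have "\<forall>\<^sub>F n in sequentially. ereal (partial_density n ?E) < ereal (1 / 4)"
    by (rule Limsup_lessD)
  then obtain N where N: "\<And>n. n \<ge> N \<Longrightarrow> partial_density n ?E < 1 / 4"
    by (auto simp: eventually_sequentially)
  have agree: "n \<in> M \<longleftrightarrow> n \<in> D" if "n \<ge> N" for n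
  proof -
    have "N \<le> 2 ^ Suc n"
      using that less_exp[of "Suc n"] by linarith
    \<comment> \<open>Density below 1/4 at \<open>2 ^ Suc n\<close> means fewer than
      \<open>2 ^ n / 2\<close> errors, so less than half of the block is wrong.\<close>
    from N[OF this] have "4 * card (?E \<inter> {0..<2 ^ Suc n}) < 2 * 2 ^ n"
      by (simp add: partial_density_def field_simps flip: of_nat_power of_nat_mult)
    moreover have "card (?E \<inter> ?B n) \<le> card (?E \<inter> {0..<2 ^ Suc n})"
      by (rule card_mono) auto
    ultimately have err: "2 * card (?E \<inter> ?B n) < 2 ^ n"
      by linarith
    have B: "x \<in> dyadic_spread D \<longleftrightarrow> n \<in> D" if "x \<in> ?B n" for x
      using that log2_eq[of n x] by (simp add: dyadic_spread_def)
    show ?thesis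
    proof (cases "n \<in> D")
      case True
      then have "?E \<inter> ?B n = ?B n - C \<inter> ?B n"
        using B by auto
      then have "card (?E \<inter> ?B n) = 2 ^ n - card (C \<inter> ?B n)"
        by (simp add: card_Diff_subset)
      with err True show ?thesis by (simp add: M_def)
    next
      case False
      then have "?E \<inter> ?B n = C \<inter> ?B n"
        using B by auto
      with err False show ?thesis by (simp add: M_def)
    qed
  qed
  \<comment> \<open>The vote is reliable only from \<open>N\<close> on; the finitely many smaller
    values are corrected by a finite set.\<close>
  have "D = (M - {..<N}) \<union> (D \<inter> {..<N})"
    using agree leI by blast
  also have "\<dots> \<le>\<^sub>T C"
    unfolding M_def
    by (intro turing_le_Un turing_le_Diff dyadic_majority_turing_le turing_le_finite) auto
  finally show ?thesis .
qed


section \<open>A continuum of sets of small density\<close>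

text \<open>Zero included, the number of multiples below \<open>n\<close> lies between
  \<open>n / m\<close> and \<open>n / m + 1\<close>, so the partial densities are squeezed to
  \<open>1 / m\<close>.\<close>

lemma upper_density_multiples:
  assumes "0 < m"
  shows "upper_density {x. m dvd x} = 1 / m"
proof -
  have card: "card ({x. m dvd x} \<inter> {0..<Suc n}) = Suc (n div m)" for n
  proof (induction n)
    case 0
    have "{x. m dvd x} \<inter> {0..<Suc 0} = {0}"
      by auto
    then show ?case by simp
  next
    case (Suc n)
    have "{x. m dvd x} \<inter> {0..<Suc (Suc n)} = (if m dvd Suc n
        then insert (Suc n) ({x. m dvd x} \<inter> {0..<Suc n}) else {x. m dvd x} \<inter> {0..<Suc n})"
      by (auto simp: less_Suc_eq)
    with Suc show ?case
      by (simp add: div_Suc mod_eq_0_iff_dvd)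
  qed
  have bounds: "1 / m \<le> partial_density n {x. m dvd x}
      \<and> partial_density n {x. m dvd x} \<le> 1 / m + 1 / n" if "0 < n" for n
  proof -
    define c where "c = card ({x. m dvd x} \<inter> {0..<n})"
    obtain n' where n': "n = Suc n'"
      using \<open>0 < n\<close> gr0_implies_Suc by blast
    have "n \<le> m * c \<and> m * c \<le> n + m"
      unfolding c_def n' card mult_Suc_right
      using assms mod_less_divisor[of m n'] mult_div_mod_eq[of m n'] by linarith
    then have "real n \<le> m * real c" "m * real c \<le> real n + m"
      by (simp_all flip: of_nat_mult of_nat_add)
    then show ?thesis
      unfolding partial_density_def c_def[symmetric]
      using assms \<open>0 < n\<close> by (simp add: field_simps)
  qed
  have "(\<lambda>n. partial_density n {x. m dvd x}) \<longlonglongrightarrow> 1 / m"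
  proof (rule tendsto_sandwich)
    show "\<forall>\<^sub>F n in sequentially. 1 / m \<le> partial_density n {x. m dvd x}"
      "\<forall>\<^sub>F n in sequentially. partial_density n {x. m dvd x} \<le> 1 / m + 1 / n"
      by (rule eventually_mono[OF eventually_gt_at_top[of 0]], use bounds in blast)+
    show "(\<lambda>n. 1 / m + 1 / real n) \<longlonglongrightarrow> 1 / m"
      using tendsto_add[OF tendsto_const lim_1_over_n] by simp
  qed simp
  then have "(\<lambda>n. ereal (partial_density n {x. m dvd x})) \<longlonglongrightarrow> ereal (1 / m)"
    by simp
  then have "limsup (\<lambda>n. ereal (partial_density n {x. m dvd x})) = ereal (1 / m)"
    by (intro lim_imp_Limsup) auto
  then show ?thesis
    by (simp flip: ereal_upper_density)
qed

lemma upper_density_multiples_power2: "upper_density {x. 2 ^ k dvd x} = (1 / 2) ^ k"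
  using upper_density_multiples[of "2 ^ k"] by (simp add: power_one_over)

lemma upper_density_mono: "A \<subseteq> B \<Longrightarrow> upper_density A \<le> upper_density B"
  using upper_density_subadd[of A B "{}"] coarsely_similar_refl[of B]
  by (simp add: coarsely_similar_iff)

section \<open>Layers of constant 2-adic valuation\<close>

definition valuation_layer :: "nat \<Rightarrow> nat set" where
  "valuation_layer k = {x. 2 ^ k dvd x} - {x. 2 ^ Suc k dvd x}"

text \<open>Subadditivity suffices: removing a set of density \<open>(1/2) ^ Suc k\<close> from one
  of density \<open>(1/2) ^ k\<close> cannot leave density zero.\<close>

lemma upper_density_valuation_layer: "0 < upper_density (valuation_layer k)"
proof -
  have "{x. 2 ^ k dvd x} \<subseteq> valuation_layer k \<union> {x. 2 ^ Suc k dvd x}"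
    by (auto simp: valuation_layer_def)
  from upper_density_subadd[OF this] have
    "(1 / 2) ^ k \<le> upper_density (valuation_layer k) + (1 / 2) ^ Suc k"
    by (simp only: upper_density_multiples_power2)
  moreover have "(1 / 2 :: real) ^ Suc k < (1 / 2) ^ k"
    by (rule power_strict_decreasing) simp_all
  ultimately show ?thesis by linarith
qed

lemma valuation_layer_disjoint:
  assumes "x \<in> valuation_layer j" "x \<in> valuation_layer k"
  shows "j = k"
proof -
  have "\<not> i < l" if "x \<in> valuation_layer i" "x \<in> valuation_layer l" for i l
    using that power_le_dvd[of 2 l x "Suc i"] by (auto simp: valuation_layer_def simp del: power_Suc)
  from this[OF assms] this[OF assms(2,1)] show ?thesis by simp
qed

lemma turing_le_valuation_layer: "valuation_layer k \<le>\<^sub>T C"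
  unfolding valuation_layer_def by (intro turing_le_Diff turing_le_multiples) simp_all

text \<open>This is \<open>R\<close> of the overview. The shift by 3 keeps the perturbation within
  density 1/8, half of the decoding radius 1/4.\<close>

definition layers :: "nat set \<Rightarrow> nat set" where
  "layers A = (\<Union>k\<in>A. valuation_layer (k + 3))"

text \<open>Layers are disjoint, so an index in just one of \<open>A\<close> and \<open>B\<close>
  puts a whole layer of positive density into the symmetric difference.\<close>

lemma layers_eq_if_coarsely_similar:
  assumes "upper_density (sym_diff (layers A) (layers B)) = 0"
  shows "A = B"
proof -
  have "valuation_layer (k + 3) \<subseteq> sym_diff (layers A) (layers B)" if "k \<in> sym_diff A B" for k
    using that by (auto simp: layers_def dest: valuation_layer_disjoint)
  then have "upper_density (valuation_layer (k + 3)) \<le> 0" if "k \<in> sym_diff A B" for k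
    using that assms upper_density_mono by metis
  then show ?thesis
    using upper_density_valuation_layer by (force simp: not_le[symmetric])
qed

text \<open>Only layers of index at least \<open>n\<close> survive, and they consist of multiples of
  \<open>2 ^ (n + 3)\<close>. Large \<open>n\<close> gives the approximation by computable sets,
  \<open>n = 0\<close> the bound 1/8.\<close>

lemma upper_density_layers_tail:
  "upper_density (sym_diff (layers A) (layers (A \<inter> {..<n}))) \<le> (1 / 2) ^ (n + 3)"
proof -
  have "sym_diff (layers A) (layers (A \<inter> {..<n})) \<subseteq> {x. 2 ^ (n + 3) dvd x}"
  proof
    fix x
    assume "x \<in> sym_diff (layers A) (layers (A \<inter> {..<n}))"
    then obtain k where "k \<notin> {..<n}" "x \<in> valuation_layer (k + 3)"
      unfolding layers_def by blast
    then show "x \<in> {x. 2 ^ (n + 3) dvd x}"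
      using power_le_dvd[of 2 "k + 3" x "n + 3"] by (auto simp: valuation_layer_def)
  qed
  from upper_density_mono[OF this] show ?thesis
    by (simp only: upper_density_multiples_power2)
qed

text \<open>Symmetric difference with a fixed set is an isometry, so the spread set drops out of
  distances between perturbations.\<close>

lemma upper_density_sym_diff_cancel_left:
  "upper_density (sym_diff (sym_diff A B) (sym_diff A C)) = upper_density (sym_diff B C)"
  by (rule arg_cong[of _ _ upper_density]) auto

section \<open>Coarse classes: distance and cardinality\<close>

lemma dist_coarse_class_of:
  "dist (coarse_class_of A) (coarse_class_of B) = upper_density (sym_diff A B)"
  by (rule dist_coarse_class.abs_eq)

text \<open>Choosing representatives injects the classes into the sets of naturals.\<close>

lemma lepoll_coarse_class_real: "(X :: coarse_class set) \<lesssim> (UNIV :: real set)"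
proof -
  have "inj rep_coarse_class"
    by (metis Quotient_coarse_class Quotient_abs_rep injI)
  then have "X \<lesssim> (UNIV :: nat set set)"
    unfolding lepoll_def by (metis inj_on_subset subset_UNIV)
  also have "\<dots> \<approx> (UNIV :: real set)"
    by (rule nat_sets_eqpoll_reals)
  finally show ?thesis .
qed

theorem theorem4p9:
  fixes d e :: turing_degree
  assumes "\<not> d \<le> e"
  shows "degree_closure d - degree_closure e \<approx> (UNIV :: real set)"
proof (rule lepoll_antisym[OF lepoll_coarse_class_real])
  obtain D where d: "d = degree_of D" by (induction d rule: turing_degree.abs_induct) blast
  obtain E where e: "e = degree_of E" by (induction e rule: turing_degree.abs_induct) blast
  define g where "g A = sym_diff (dyadic_spread D) (layers A)" for A
  \<comment> \<open>A closer \<open>C\<close> would compute \<open>D\<close>, and then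
    \<open>E\<close> would compute \<open>D\<close>, against the assumption.\<close>
  have far: "1 / 4 \<le> upper_density (sym_diff C (dyadic_spread D))" if "C \<le>\<^sub>T E" for C
    using assms turing_le_if_near_dyadic_spread[of C D] turing_le_trans[OF _ that]
    unfolding d e less_eq_turing_degree.abs_eq by force
  have g_d: "coarse_class_of (g A) \<in> degree_closure d" for A
    unfolding degree_closure_def closure_approachable
  proof (intro allI impI)
    fix r :: real
    assume "0 < r"
    then obtain n where n: "(1 / 2) ^ n < r"
      using real_arch_pow_inv[of r "1 / 2"] by auto
    have "(1 / 2 :: real) ^ (n + 3) \<le> (1 / 2) ^ n"
      by (rule power_decreasing) simp_all
    then have "dist (coarse_class_of (g (A \<inter> {..<n}))) (coarse_class_of (g A)) < r"
      using n upper_density_layers_tail[of A n] unfolding dist_commute[of "coarse_class_of (g (A \<inter> {..<n}))"]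
      by (simp only: dist_coarse_class_of g_def upper_density_sym_diff_cancel_left)
    \<comment> \<open>Truncation makes this a finite union of computable layers, however complex
      \<open>A\<close> is.\<close>
    moreover have "layers (A \<inter> {..<n}) \<le>\<^sub>T D"
      unfolding layers_def by (rule turing_le_finite_UN) (simp_all add: turing_le_valuation_layer)
    then have "g (A \<inter> {..<n}) \<le>\<^sub>T D"
      unfolding g_def by (simp add: turing_le_Un turing_le_Diff dyadic_spread_turing_le)
    ultimately show "\<exists>y\<in>{coarse_class_of A |A. degree_of A \<le> d}. dist y (coarse_class_of (g A)) < r"
      unfolding d less_eq_turing_degree.abs_eq by blast
  qed
  have g_e: "coarse_class_of (g A) \<notin> degree_closure e" for A
  proof
    assume "coarse_class_of (g A) \<in> degree_closure e"
    moreover have "(0::real) < 1 / 8" by simp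
    ultimately obtain C where C: "C \<le>\<^sub>T E"
        "dist (coarse_class_of C) (coarse_class_of (g A)) < 1 / 8"
      unfolding degree_closure_def closure_approachable e less_eq_turing_degree.abs_eq by blast
    \<comment> \<open>The truncation at 0 is empty, so the tail bound controls all of
      \<open>layers A\<close>.\<close>
    have "sym_diff (g A) (dyadic_spread D) = sym_diff (layers A) (layers (A \<inter> {..<0}))"
      by (auto simp: g_def layers_def)
    with upper_density_layers_tail[of A 0]
    have "upper_density (sym_diff (g A) (dyadic_spread D)) \<le> 1 / 8"
      by (simp add: power3_eq_cube)
    \<comment> \<open>The triangle inequality would give a distance below 1/8 + 1/8 from
      \<open>C\<close> to the spread set.\<close>
    with far[OF C(1)] C(2) upper_density_sym_diff_triangle[of C "dyadic_spread D" "g A"]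
    show False
      unfolding dist_coarse_class_of by linarith
  qed
  have "inj (\<lambda>A. coarse_class_of (g A))"
  proof (rule injI)
    fix A B
    assume "coarse_class_of (g A) = coarse_class_of (g B)"
    then have "dist (coarse_class_of (g A)) (coarse_class_of (g B)) = 0"
      by simp
    then show "A = B"
      unfolding dist_coarse_class_of g_def upper_density_sym_diff_cancel_left
      by (rule layers_eq_if_coarsely_similar)
  qed
  then have "(UNIV :: nat set set) \<lesssim> degree_closure d - degree_closure e"
    unfolding lepoll_def using g_d g_e by (intro exI conjI) auto
  then show "(UNIV :: real set) \<lesssim> degree_closure d - degree_closure e"
    by (rule lepoll_trans1[OF eqpoll_sym[OF nat_sets_eqpoll_reals]])
qed

end
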